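(* Let $g,h\notin\{-\tfrac12,-\tfrac32,-\tfrac52,\dots\}$ and let $k\in\mathbb{Z}_{\ge 0}$. The $X_1$-Jacobi polynomial $\hat P_k(\eta)$ is expressed in terms of a generalized hypergeometric function as $$\hat P_k(\eta)=D_k\cdot{}_4F_3\left(\begin{array}{c}-k-1,\;k+g+h+1,\;e_1+1,\;e_2+1\\ g+\tfrac32,\;e_1,\;e_2\end{array};\frac{1-\eta}{2}\right),$$ where $e_1,e_2$ are determined (up to order) by $$e_1+e_2=2g,\qquad e_1e_2=\frac{-(k+1)(k+g+h+1)(2g+1)}{2h+1},$$ and $D_k$ is a non-zero constant.
   Context: Notation: $(a)_n=a(a+1)\cdots(a+n-1)$, and $${}_4F_3\left(\begin{array}{c}a_1,\dots,a_4\\ b_1,b_2,b_3\end{array};z\right)=\sum_{n\ge 0}\frac{(a_1)_n\cdots(a_4)_n}{(b_1)_n(b_2)_n(b_3)_n\,n!}z^n.$$ The Jacobi polynomial is parametrized as $$P_k(\eta)=\frac{(g+\frac12)_k}{k!}\sum_{j=0}^k\frac{(-k)_j(k+g+h+2)_j}{j!\,(g+\frac12)_j}\left(\frac{1-\eta}{2}\right)^j .$$ The $X_1$-Jacobi polynomials $\hat P_k(\eta)$, $k=0,1,2,\dots$, are defined for $g,h\notin\{-\frac12,-\frac32,-\frac52,\dots\}$ by $$\hat P_k(\eta)=\frac{1}{k+h+\frac12}\left(\left(h+\tfrac12\right)\tilde\xi(\eta)P_k(\eta)+(1+\eta)\xi(\eta)\frac{d}{d\eta}P_k(\eta)\right),$$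 $$\xi(\eta)=\frac{g-h}{2}\eta+\frac{g+h+1}{2},\qquad \tilde\xi(\eta)=\frac{g-h}{2}\eta+\frac{g+h+3}{2}.$$
   Formalization: The identity is claimed only when the 4F3 series is meaningful: e_1 and e_2 are non-zero, and (e_1)_n, (e_2)_n do not vanish before the series terminates through -k-1 or k+g+h+1; otherwise (e.g. k+g+h+1=0, or g=0, h=-8, k=2) it contains 0/0 terms. *)

theory Defs
  imports "HOL-Analysis.Analysis"
begin

definition Jacobi_P :: "complex \<Rightarrow> complex \<Rightarrow> nat \<Rightarrow> complex poly" where
  "Jacobi_P g h k =
     smult (pochhammer (g + 1/2) k / fact k)
       (\<Sum>j\<le>k. smult (pochhammer (- of_nat k) j * pochhammer (of_nat k + g + h + 2) j
                        / (fact j * pochhammer (g + 1/2) j))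
                 ([:1/2, -1/2:] ^ j))"

definition xi :: "complex \<Rightarrow> complex \<Rightarrow> complex poly" where
  "xi g h = [:(g + h + 1) / 2, (g - h) / 2:]"

definition xi_tilde :: "complex \<Rightarrow> complex \<Rightarrow> complex poly" where
  "xi_tilde g h = [:(g + h + 3) / 2, (g - h) / 2:]"

definition X1_Jacobi_P :: "complex \<Rightarrow> complex \<Rightarrow> nat \<Rightarrow> complex poly" where
  "X1_Jacobi_P g h k =
     smult (1 / (of_nat k + h + 1/2))
       (smult (h + 1/2) (xi_tilde g h * Jacobi_P g h k)
        + [:1, 1:] * xi g h * pderiv (Jacobi_P g h k))"

text \<open>
  The series is taken literally, with the convention \<open>x / 0 = 0\<close>, so
  \<open>pochhammer (e + 1) n / pochhammer e n\<close> is not cancelled to \<open>(e + n) / e\<close>: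
  if \<open>e\<close> is a negative integer, the quotient is \<open>0\<close> for \<open>n > - e\<close>.
\<close>

definition hypergeo_4F3 ::
  "complex \<Rightarrow> complex \<Rightarrow> complex \<Rightarrow> complex \<Rightarrow> complex \<Rightarrow> complex \<Rightarrow> complex \<Rightarrow> complex \<Rightarrow> complex" where
  "hypergeo_4F3 a1 a2 a3 a4 b1 b2 b3 z = eval_fps (fps_hypergeo [a1, a2, a3, a4] [b1, b2, b3] 1) z"

text \<open>
  For the series with upper parameters \<open>- k - 1, k + g + h + 1, e1 + 1, e2 + 1\<close> and
  lower parameters \<open>g + 3/2, e1, e2\<close>: no denominator vanishes before the sum is terminated by
  one of the first two upper parameters (\<open>g + 3/2\<close> is unproblematic by the standing
  assumption on \<open>g\<close>). The upper parameters \<open>e1 + 1\<close> and \<open>e2 + 1\<close> do not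
  count as terminating, since the lower parameters \<open>e1\<close> and \<open>e2\<close> compensate their zeros.
  The condition \<open>e1 \<noteq> 0\<close>, \<open>e2 \<noteq> 0\<close> is separate because for
  \<open>k + g + h + 1 = 0\<close>, where \<open>e1 * e2 = 0\<close>, all terms with \<open>n > 0\<close> are of the
  form \<open>0 / 0\<close>.
\<close>

definition X1_series_defined :: "complex \<Rightarrow> complex \<Rightarrow> nat \<Rightarrow> complex \<Rightarrow> complex \<Rightarrow> bool" where
  "X1_series_defined g h k e1 e2 \<longleftrightarrow>
     e1 \<noteq> 0 \<and> e2 \<noteq> 0 \<and>
     (\<forall>n. pochhammer (- of_nat k - 1) n * pochhammer (of_nat k + g + h + 1) n \<noteq> 0 \<longrightarrow>
          pochhammer e1 n \<noteq> 0 \<and> pochhammer e2 n \<noteq> 0)"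

end

theory Submission
  imports Defs
begin

text \<open>
  Put \<open>a = g + 1/2\<close>, \<open>b = h + 1/2\<close> and \<open>z = (1 - \<eta>) / 2\<close>. The Jacobi polynomial is then a constant
  multiple of \<open>f = \<Sum>n. c n * z ^ n\<close>, where \<open>c (n + 1) / c n\<close> is a rational function of \<open>n\<close>, and
  \<open>1 + \<eta> = 2 * (1 - z)\<close>, \<open>d/d\<eta> = - (1/2) * d/dz\<close>, so that the \<open>X\<^sub>1\<close>-Jacobi polynomial is a constant
  multiple of
  \<open>b * (a + 1 - (a - b) * z) * f - (1 - z) * (a - (a - b) * z) * f'\<close>.

  Multiplication by \<open>z\<close> and differentiation shift the index, hence the coefficient of \<open>z ^ n\<close> is a
  combination of \<open>c (n - 1)\<close>, \<open>c n\<close> and \<open>c (n + 1)\<close>, and for \<open>n > 0\<close> the ratio above turns it into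
  \<open>c (n - 1)\<close> times a rational function of \<open>n\<close>. The numerator of that function, a priori of high
  degree, collapses: up to a factor that does not depend on \<open>n\<close> it equals
  \<open>n\<^sup>2 + (2 * a - 1) * n + E\<close> with \<open>b * E = - (k + 1) * (k + a + b) * a\<close>, which is
  \<open>(n + e1) * (n + e2)\<close> for the \<open>e1\<close>, \<open>e2\<close> of the theorem; and \<open>(e + n) / e\<close> is the
  quotient of the Pochhammer symbols of \<open>e + 1\<close> and \<open>e\<close>. The remaining factor
  \<open>c (n - 1) / (n * (a + n - 1) * (a + n))\<close>, multiplied by \<open>b * E\<close>, is the coefficient of the series with
  upper parameters \<open>- k - 1\<close>, \<open>k + a + b\<close> and lower parameter \<open>a + 1\<close>, because lowering an upper
  parameter by one is the same as shifting the index. This is lemma \<open>coeff_x1_poly\<close>.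
  The constant is found at \<open>n = 0\<close>, where the coefficient is \<open>(k + b) * (k + a + 1)\<close>.

  The factorization holds for every \<open>n\<close>, also beyond the degree, so the polynomial and the hypergeometric
  series can be compared as formal power series. Termination matters only for the quotients of Pochhammer
  symbols: where one of them does not simplify to \<open>(e + n) / e\<close>, another factor of the coefficient is zero.
\<close>

definition jacobi_coeff :: "complex \<Rightarrow> complex \<Rightarrow> nat \<Rightarrow> nat \<Rightarrow> complex" where
  "jacobi_coeff a b k j =
     pochhammer (- of_nat k) j * pochhammer (of_nat k + a + b + 1) j / (fact j * pochhammer a j)"

definition jacobi_poly :: "complex \<Rightarrow> complex \<Rightarrow> nat \<Rightarrow> complex poly" where
  "jacobi_poly a b k = (\<Sum>j\<le>k. monom (jacobi_coeff a b k j) j)"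

text \<open>
  The \<open>X\<^sub>1\<close>-Jacobi polynomial in the variable \<open>z = (1 - \<eta>) / 2\<close>, up to a constant factor. The factor
  of the derivative is the expanded form of \<open>(1 - z) * (a - (a - b) * z)\<close>.
\<close>

definition x1_poly :: "complex \<Rightarrow> complex \<Rightarrow> nat \<Rightarrow> complex poly" where
  "x1_poly a b k = smult b ([:a + 1, b - a:] * jacobi_poly a b k)
     - [:a, b - 2 * a, a - b:] * pderiv (jacobi_poly a b k)"

lemma coeff_jacobi_poly: "coeff (jacobi_poly a b k) n = jacobi_coeff a b k n"
proof (cases "n \<le> k")
  case True
  then show ?thesis by (simp add: jacobi_poly_def coeff_sum)
next
  case False
  then show ?thesis
    by (simp add: jacobi_poly_def jacobi_coeff_def coeff_sum pochhammer_of_nat_eq_0_lemma)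
qed

lemma jacobi_coeff_Suc:
  "jacobi_coeff a b k (Suc n) =
     jacobi_coeff a b k n * ((of_nat n - of_nat k) * (of_nat k + a + b + 1 + of_nat n)
       / ((of_nat n + 1) * (a + of_nat n)))"
  by (simp add: jacobi_coeff_def pochhammer_rec' mult_ac add_ac)

text \<open>
  The change of variable is a composition of polynomials; the chain rule contributes the factor \<open>- 1/2\<close>,
  which cancels against the \<open>2\<close> in \<open>1 + \<eta> = 2 * (1 - z)\<close>.
\<close>

lemma X1_Jacobi_P_eq_x1_poly:
  fixes g h :: complex
  defines "a \<equiv> g + 1/2" and "b \<equiv> h + 1/2"
  shows "poly (X1_Jacobi_P g h k) \<eta> =
    pochhammer a k / fact k / (of_nat k + b) * poly (x1_poly a b k) ((1 - \<eta>) / 2)"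
proof -
  have "[:1/2, -1/2::complex:] ^ j = pcompose (monom 1 j) [:1/2, -1/2:]" for j
    by (induction j) (simp_all add: monom_0 monom_Suc pcompose_pCons)
  then have "Jacobi_P g h k = smult (pochhammer a k / fact k) (pcompose (jacobi_poly a b k) [:1/2, -1/2:])"
    unfolding Jacobi_P_def jacobi_poly_def pcompose_sum
    by (simp add: jacobi_coeff_def a_def b_def algebra_simps flip: pcompose_smult smult_monom)
       (simp add: smult_monom)
  moreover define z where "z = (1 - \<eta>) / 2"
  ultimately have P: "poly (Jacobi_P g h k) \<eta> = pochhammer a k / fact k * poly (jacobi_poly a b k) z"
    and P': "poly (pderiv (Jacobi_P g h k)) \<eta> =
      - (pochhammer a k / fact k * poly (pderiv (jacobi_poly a b k)) z) / 2"
    by (simp_all add: pderiv_smult pderiv_pcompose pderiv_pCons poly_pcompose diff_divide_distrib)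
  have subst: "\<eta> = 1 - 2 * z" "g = a - 1/2" "h = b - 1/2"
    by (simp_all add: z_def a_def b_def diff_divide_distrib)
  have xi: "poly (xi g h) \<eta> = a + (b - a) * z" "poly (xi_tilde g h) \<eta> = a + 1 + (b - a) * z"
    unfolding xi_def xi_tilde_def subst by (simp_all add: field_simps)
  have kh: "of_nat k + h + 1/2 = of_nat k + b" "h + 1/2 = b" "poly [:1, 1:] \<eta> = 2 * (1 - z)"
    by (simp_all add: z_def b_def field_simps)
  have q: "poly [:a, b - 2 * a, a - b:] z = (1 - z) * (a + (b - a) * z)"
      "poly [:a + 1, b - a:] z = a + 1 + (b - a) * z"
    by (simp_all add: algebra_simps)
  have factor: "1 / d * (b * (u * (c * f)) + 2 * (1 - z) * w * (- (c * f') / 2))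
      = c / d * (b * (u * f) - (1 - z) * w * f')" for c d u f w f' :: complex
  proof -
    have "b * (u * (c * f)) + 2 * (1 - z) * w * (- (c * f') / 2)
        = c * (b * (u * f) - (1 - z) * w * f')"
      by (simp add: algebra_simps)
    then show ?thesis by simp
  qed
  have "poly (X1_Jacobi_P g h k) \<eta> = 1 / (of_nat k + b) *
     (b * ((a + 1 + (b - a) * z) * poly (Jacobi_P g h k) \<eta>)
      + 2 * (1 - z) * (a + (b - a) * z) * poly (pderiv (Jacobi_P g h k)) \<eta>)"
    unfolding X1_Jacobi_P_def poly_smult poly_add poly_mult kh xi by (simp only: mult.assoc)
  also have "\<dots> = pochhammer a k / fact k / (of_nat k + b) *
     (b * ((a + 1 + (b - a) * z) * poly (jacobi_poly a b k) z)
      - (1 - z) * (a + (b - a) * z) * poly (pderiv (jacobi_poly a b k)) z)"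
    unfolding P P' by (rule factor)
  finally show ?thesis
    unfolding x1_poly_def z_def[symmetric] poly_diff poly_smult poly_mult q by (simp add: mult_ac)
qed

lemma coeff_x1_poly_0:
  assumes "a \<noteq> 0"
  shows "coeff (x1_poly a b k) 0 = (of_nat k + b) * (of_nat k + a + 1)"
  using assms by (simp add: x1_poly_def coeff_pderiv coeff_jacobi_poly jacobi_coeff_def field_simps)

lemma coeff_x1_poly_Suc:
  "coeff (x1_poly a b k) (Suc n) =
     (b * (a + 1) + (2 * a - b) * (of_nat n + 1)) * jacobi_coeff a b k (Suc n)
     - (a - b) * (b + of_nat n) * jacobi_coeff a b k n
     - a * (of_nat n + 2) * jacobi_coeff a b k (Suc (Suc n))"
proof -
  have "coeff (pCons 0 (smult (a - b) (pderiv (jacobi_poly a b k)))) n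
      = (a - b) * (of_nat n * jacobi_coeff a b k n)"
    by (cases n) (simp_all add: coeff_pderiv coeff_jacobi_poly)
  then show ?thesis
    by (simp add: x1_poly_def coeff_pderiv coeff_jacobi_poly)
       (simp add: algebra_simps)
qed

text \<open>
  The heart of the argument: the three-term combination of Jacobi coefficients factors. Both sides are written
  in terms of the single coefficient \<open>c (n - 1)\<close>, after which the claim is an identity of
  polynomials in \<open>a\<close>, \<open>b\<close>, \<open>k\<close> and \<open>n\<close>. The factor \<open>E\<close> stays on the left-hand side
  because it can be zero, namely for \<open>k + a + b = 0\<close>.
\<close>

lemma coeff_x1_poly:
  assumes a: "\<And>m. a + of_nat m \<noteq> 0"
    and E: "b * E = - (of_nat k + 1) * (of_nat k + a + b) * a"
  shows "coeff (x1_poly a b k) n * E = (of_nat k + b) * (of_nat k + a + 1) *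
    (pochhammer (- of_nat k - 1) n * pochhammer (of_nat k + a + b) n
       / (pochhammer (a + 1) n * fact n))
    * ((of_nat n)\<^sup>2 + (2 * a - 1) * of_nat n + E)"
proof (cases n)
  case 0
  then show ?thesis using coeff_x1_poly_0 a[of 0] by simp
next
  case (Suc m)
  define c where "c = jacobi_coeff a b k m"
  define K N :: complex where "K = of_nat k" and "N = of_nat m"
  have nz: "a + N \<noteq> 0" "a + N + 1 \<noteq> 0" "a \<noteq> 0" "N + 1 \<noteq> 0" "N + 2 \<noteq> 0"
    using a[of m] a[of "Suc m"] a[of 0] of_nat_neq_0[of m, where 'a=complex]
      of_nat_neq_0[of "Suc m", where 'a=complex]
    by (simp_all add: N_def add_ac)
  have c1: "jacobi_coeff a b k (Suc m) = c * ((N - K) * (K + a + b + 1 + N) / ((N + 1) * (a + N)))"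
    by (simp add: jacobi_coeff_Suc c_def K_def N_def)
  have c2: "jacobi_coeff a b k (Suc (Suc m)) = jacobi_coeff a b k (Suc m) *
       ((N + 1 - K) * (K + a + b + 2 + N) / ((N + 2) * (a + N + 1)))"
    by (subst jacobi_coeff_Suc) (simp add: c_def K_def N_def algebra_simps)
  have "pochhammer (a + 1) n * a = pochhammer a m * (a + N) * (a + N + 1)"
    using pochhammer_rec[of a "Suc m"] by (simp add: Suc N_def pochhammer_rec' algebra_simps)
  then have "pochhammer (a + 1) n = pochhammer a m * (a + N) * (a + N + 1) / a"
    using nz by (simp add: field_simps)
  moreover have "pochhammer (- of_nat k - 1 :: complex) n = - (K + 1) * pochhammer (- K) m"
    by (simp add: Suc pochhammer_rec K_def)
  moreover have "pochhammer (of_nat k + a + b) n = (K + a + b) * pochhammer (K + a + b + 1) m"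
    by (simp add: Suc pochhammer_rec K_def)
  moreover have "fact n = (N + 1) * (fact m :: complex)"
    by (simp add: Suc N_def)
  \<comment> \<open>The symbols of \<open>- k - 1\<close>, \<open>k + a + b\<close> and \<open>a + 1\<close> are those of \<open>- k\<close>, \<open>k + a + b + 1\<close> and \<open>a\<close> with shifted
    index, so the factor in front of \<open>c\<close> is \<open>b * E / (n * (a + n - 1) * (a + n))\<close>, by the assumption on \<open>E\<close>.\<close>
  ultimately have u: "pochhammer (- of_nat k - 1) n * pochhammer (of_nat k + a + b) n
       / (pochhammer (a + 1) n * fact n) = - (K + 1) * (K + a + b) * a * c / ((N + 1) * (a + N) * (a + N + 1))"
    by (simp add: c_def jacobi_coeff_def K_def mult_ac)
  have *: "coeff (x1_poly a b k) n * ((N + 1) * (a + N) * (a + N + 1)) =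
     (K + b) * (K + a + 1) * c * (b * (N + 1)\<^sup>2 + b * (2 * a - 1) * (N + 1) - (K + 1) * (K + a + b) * a)"
    unfolding Suc coeff_x1_poly_Suc c2 c1
    using nz by (simp add: c_def[symmetric] N_def[symmetric] divide_simps) algebra
  have G: "coeff (x1_poly a b k) n = (K + b) * (K + a + 1) * c * (b * ((N + 1)\<^sup>2 + (2 * a - 1) * (N + 1) + E))
     / ((N + 1) * (a + N) * (a + N + 1))"
  proof -
    have "b * (N + 1)\<^sup>2 + b * (2 * a - 1) * (N + 1) - (K + 1) * (K + a + b) * a
        = b * ((N + 1)\<^sup>2 + (2 * a - 1) * (N + 1) + E)"
      using E[folded K_def] by algebra
    with * show ?thesis using nz by (simp add: eq_divide_eq)
  qed
  show ?thesis
    unfolding u G E[symmetric, folded K_def]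
    by (simp add: Suc K_def N_def mult_ac add_ac)
qed

lemma pochhammer_shift_quotient:
  fixes e :: complex
  assumes "e \<noteq> 0" "pochhammer e n \<noteq> 0"
  shows "pochhammer (e + 1) n / pochhammer e n = (e + of_nat n) / e"
  using assms pochhammer_rec[of e n] pochhammer_rec'[of e n]
  by (simp add: field_simps)

lemma ex_sum_product_pair:
  fixes s p :: complex
  shows "\<exists>u v. u + v = s \<and> u * v = p"
proof -
  define d where "d = csqrt (s\<^sup>2 - 4 * p)"
  have "d\<^sup>2 = s\<^sup>2 - 4 * p" by (simp add: d_def)
  then have "(s + d) / 2 + (s - d) / 2 = s \<and> (s + d) / 2 * ((s - d) / 2) = p"
    by (simp add: field_simps power2_eq_square)
  then show ?thesis by blast
qed

lemma sum_product_determine_pair: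
  fixes x y u v :: "'a::idom"
  shows "x + y = u + v \<and> x * y = u * v \<longleftrightarrow> (x = u \<and> y = v) \<or> (x = v \<and> y = u)"
proof
  assume *: "x + y = u + v \<and> x * y = u * v"
  then have "(x - u) * (x - v) = 0" by algebra
  with * show "(x = u \<and> y = v) \<or> (x = v \<and> y = u)" by auto
qed (auto simp: ac_simps)

theorem theorem6p1:
  fixes g h :: complex and k :: nat
  assumes g: "\<And>m::nat. g \<noteq> - (1/2) - of_nat m"
    and h: "\<And>m::nat. h \<noteq> - (1/2) - of_nat m"
  shows "\<exists>e1 e2.
    (\<forall>x y. (x + y = 2 * g \<and>
            x * y = - (of_nat k + 1) * (of_nat k + g + h + 1) * (2 * g + 1) / (2 * h + 1))
           \<longleftrightarrow> (x = e1 \<and> y = e2) \<or> (x = e2 \<and> y = e1)) \<and>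
    (X1_series_defined g h k e1 e2 \<longrightarrow>
      (\<exists>D. D \<noteq> 0 \<and>
        (\<forall>\<eta>. poly (X1_Jacobi_P g h k) \<eta> =
          D * hypergeo_4F3 (- of_nat k - 1) (of_nat k + g + h + 1) (e1 + 1) (e2 + 1)
                           (g + 3/2) e1 e2 ((1 - \<eta>) / 2))))"
proof -
  define a b where "a = g + 1/2" and "b = h + 1/2"
  have a: "a + of_nat m \<noteq> 0" for m using g[of m] by (auto simp: a_def field_simps add_eq_0_iff)
  have b: "b + of_nat m \<noteq> 0" for m using h[of m] by (auto simp: b_def field_simps add_eq_0_iff)
  define E where "E = - (of_nat k + 1) * (of_nat k + g + h + 1) * (2 * g + 1) / (2 * h + 1)"
  have bE: "b * E = - (of_nat k + 1) * (of_nat k + a + b) * a"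
  proof -
    have "2 * g + 1 = 2 * a" "2 * h + 1 = 2 * b" "of_nat k + g + h + 1 = of_nat k + a + b"
      by (simp_all add: a_def b_def)
    then show ?thesis using b[of 0] by (simp add: E_def)
  qed
  obtain e1 e2 where e: "e1 + e2 = 2 * g" "e1 * e2 = E"
    using ex_sum_product_pair by blast
  define D' where "D' = (of_nat k + b) * (of_nat k + a + 1)"
  have D': "D' \<noteq> 0" using a[of "Suc k"] b[of k] by (simp add: D'_def add_ac)
  define D where "D = pochhammer a k / fact k / (of_nat k + b) * D'"
  have D: "D \<noteq> 0"
    using D' a b[of k] by (auto simp: D_def pochhammer_eq_0_iff add_ac eq_neg_iff_add_eq_0)
  have "poly (X1_Jacobi_P g h k) \<eta> =
          D * hypergeo_4F3 (- of_nat k - 1) (of_nat k + g + h + 1) (e1 + 1) (e2 + 1)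
                           (g + 3/2) e1 e2 ((1 - \<eta>) / 2)"
    if defd: "X1_series_defined g h k e1 e2" for \<eta>
  proof -
    have e0: "e1 \<noteq> 0" "e2 \<noteq> 0" using defd by (auto simp: X1_series_defined_def)
    then have E0: "E \<noteq> 0" using e by auto
    have M: "of_nat k + g + h + 1 = of_nat k + a + b" and a1: "g + 3/2 = a + 1"
      by (simp_all add: a_def b_def)
    have "fps_hypergeo [- of_nat k - 1, of_nat k + g + h + 1, e1 + 1, e2 + 1] [g + 3/2, e1, e2] 1
        = fps_of_poly (smult (1 / D') (x1_poly a b k))"
    proof (rule fps_ext)
      fix n
      let ?pq = "pochhammer (- of_nat k - 1) n * pochhammer (of_nat k + a + b) n"
      have divide: "u * (q / E) = c / D'" if "c * E = D' * u * q" for u q c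
        using that D' E0 by (simp add: field_simps)
      have "fps_nth (fps_hypergeo [- of_nat k - 1, of_nat k + g + h + 1, e1 + 1, e2 + 1]
              [g + 3/2, e1, e2] 1) n
          = ?pq / (pochhammer (a + 1) n * fact n)
            * (pochhammer (e1 + 1) n / pochhammer e1 n) * (pochhammer (e2 + 1) n / pochhammer e2 n)"
        by (simp add: M a1)
      also have "\<dots> = ?pq / (pochhammer (a + 1) n * fact n) * ((e1 + of_nat n) / e1 * ((e2 + of_nat n) / e2))"
        \<comment> \<open>Once the series has terminated, both sides vanish whatever the quotients are.\<close>
      proof (cases "?pq = 0")
        case False
        then have "pochhammer e1 n \<noteq> 0" "pochhammer e2 n \<noteq> 0"
          using defd by (auto simp: X1_series_defined_def M)
        then show ?thesis by (simp add: pochhammer_shift_quotient e0 mult.assoc)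
      qed auto
      also have "(e1 + of_nat n) / e1 * ((e2 + of_nat n) / e2) =
          ((of_nat n)\<^sup>2 + (2 * a - 1) * of_nat n + E) / E"
      proof -
        have "2 * a - 1 = e1 + e2" by (simp add: a_def e)
        then show ?thesis
          unfolding e(2)[symmetric] by (simp add: power2_eq_square algebra_simps)
      qed
      also have "?pq / (pochhammer (a + 1) n * fact n)
          * (((of_nat n)\<^sup>2 + (2 * a - 1) * of_nat n + E) / E) = coeff (x1_poly a b k) n / D'"
        by (rule divide) (simp add: coeff_x1_poly[OF a bE] D'_def)
      finally show "fps_nth (fps_hypergeo [- of_nat k - 1, of_nat k + g + h + 1, e1 + 1, e2 + 1]
              [g + 3/2, e1, e2] 1) n = fps_nth (fps_of_poly (smult (1 / D') (x1_poly a b k))) n"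
        by simp
    qed
    then show ?thesis
      using D' X1_Jacobi_P_eq_x1_poly[of g h k \<eta>]
      by (simp add: hypergeo_4F3_def D_def a_def b_def)
  qed
  moreover have "(x + y = 2 * g \<and> x * y = E) \<longleftrightarrow> (x = e1 \<and> y = e2) \<or> (x = e2 \<and> y = e1)" for x y
    using sum_product_determine_pair[of x y e1 e2] e by simp
  ultimately show ?thesis
    using D unfolding E_def by blast
qed

end
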